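(* Let $c,g\in\mathbb R$ with $g\ne0$, and let $S\subset\mathbb R^3$ be the Dupin cyclide of Type III in canonical form, i.e. the zero set of $$(x+c)(x^2+y^2+z^2)+(y^2-z^2)g-(g^2+c^2)x+(g^2-c^2)c,$$ with spine curves and radius functions $$\mathbf c_1(t)=g\big(t^2-\tfrac12,2t,0\big),\quad r_1(t)=c+g\big(t^2+\tfrac12\big),\qquad \mathbf c_2(t)=g\big(\tfrac12-t^2,0,2t\big),\quad r_2(t)=c-g\big(t^2+\tfrac12\big).$$ Let $\mathbf f$ denote an isometry of $\mathbb R^3$ and $\varphi_1,\varphi_2$ Möbius transformations. 1. The conditions (A1) $\mathbf f\circ\mathbf c_1=\mathbf c_1\circ\varphi_1$ and $\mathbf f\circ\mathbf c_2=\mathbf c_2\circ\varphi_2$, and (A2) $r_1^2=(r_1\circ\varphi_1)^2$ and $r_2^2=(r_2\circ\varphi_2)^2$, are satisfied if and only if $(\varphi_1,\varphi_2)$ and $\mathbf f$ are given by one of the cases (a)–(d) below. 2. The conditions (B1) $\mathbf f\circ\mathbf c_1=\mathbf c_2\circ\varphi_1$ and $\mathbf f\circ\mathbf c_2=\mathbf c_1\circ\varphi_2$, and (B2) $r_1^2=(r_2\circ\varphi_1)^2$ and $r_2^2=(r_1\circ\varphi_2)^2$, are satisfied if and only if $c=0$ and $(\varphi_1,\varphi_2)$ and $\mathbf f$ are given by one of the cases (i)–(l) below. In particular: if $c\ne0$, the symmetries of $S$ are exactly the maps $\mathbf f$ in (a)–(d), forming a group isomorphic to $\mathbb Z_2^2$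 (the Klein four group); if $c=0$, the symmetries of $S$ are exactly the maps $\mathbf f$ in (a)–(d) and (i)–(l), forming a group isomorphic to $D_4$, the dihedral group of order eight. The cases, listing $(\varphi_1(t),\varphi_2(t))$ and $\mathbf f(x,y,z)$, are: (a) $(t,t)$, $(x,y,z)$; (b) $(t,-t)$, $(x,y,-z)$; (c) $(-t,t)$, $(x,-y,z)$; (d) $(-t,-t)$, $(x,-y,-z)$; (i) $(t,t)$, $(-x,z,y)$; (j) $(-t,-t)$, $(-x,-z,-y)$; (k) $(t,-t)$, $(-x,-z,y)$; (l) $(-t,t)$, $(-x,z,-y)$.
   Context: A Möbius transformation is a real rational function $\varphi(t)=\frac{\alpha t+\beta}{\gamma t+\delta}$ with real coefficients and $\alpha\delta-\beta\gamma\ne0$. An isometry of $\mathbb R^3$ is a map $\mathbf x\mapsto\mathbf Q\mathbf x+\mathbf b$ with $\mathbf Q$ orthogonal and $\mathbf b\in\mathbb R^3$; it is a symmetry of $S$ if it maps $S$ onto $S$. Identities between compositions are identities of rational functions. A pair $(\mathbf c_i,r_i)$ represents $S$ as the envelope of the spheres with center $\mathbf c_i(t)$ (spine curve) and radius $r_i(t)$ (radius function). *)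

theory Defs
  imports
    "HOL-Analysis.Analysis"
    "HOL-Computational_Algebra.Computational_Algebra"
    "HOL-Algebra.Elementary_Groups"
begin

text \<open>The rational functions form the field \<open>\<real>(t)\<close> of fractions of \<open>real poly\<close>, so an identity
  between rational functions is an equality in this field.\<close>

type_synonym ratfun = "real poly fract"

definition ratconst :: "real \<Rightarrow> ratfun"
  where "ratconst a = to_fract [:a:]"

definition ratvar :: ratfun
  where "ratvar = to_fract [:0, 1:]"

definition moebius_transf :: "ratfun \<Rightarrow> bool"
  where "moebius_transf \<phi> \<longleftrightarrow> (\<exists>\<alpha> \<beta> \<gamma> \<delta> :: real. \<alpha> * \<delta> - \<beta> * \<gamma> \<noteq> 0 \<and>
           \<phi> = Fraction_Field.Fract [:\<beta>, \<alpha>:] [:\<delta>, \<gamma>:])"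

text \<open>The spine curves and radius functions are polynomial. Composition of a polynomial with a
  rational function is substitution for the variable, that is, evaluation of the polynomial at an
  element of \<open>\<real>(t)\<close>.\<close>

definition subst_fun :: "real poly \<Rightarrow> ratfun \<Rightarrow> ratfun"
  where "subst_fun p \<phi> = poly (map_poly ratconst p) \<phi>"

definition subst_curve :: "real poly ^ 3 \<Rightarrow> ratfun \<Rightarrow> ratfun ^ 3"
  where "subst_curve C \<phi> = (\<chi> i. subst_fun (C $ i) \<phi>)"

definition isometry3 :: "(real ^ 3 \<Rightarrow> real ^ 3) \<Rightarrow> bool"
  where "isometry3 f \<longleftrightarrow> (\<exists>Q b. orthogonal_matrix Q \<and> (\<forall>v. f v = Q *v v + b))"

text \<open>The composition \<open>f \<circ> C\<close> of an affine map \<open>f\<close> with a polynomial curve, as a triple of rational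
  functions. The matrix and the translation vector of \<open>f\<close> are recovered from \<open>f\<close>.\<close>

definition map_curve :: "(real ^ 3 \<Rightarrow> real ^ 3) \<Rightarrow> real poly ^ 3 \<Rightarrow> ratfun ^ 3"
  where "map_curve f C = (\<chi> i. to_fract
           ((\<Sum>j\<in>UNIV. smult (matrix (\<lambda>v. f v - f 0) $ i $ j) (C $ j)) + [:f 0 $ i:]))"

lemma map_curve_affine:
  assumes "\<And>v. f v = Q *v v + b"
  shows "map_curve f C = (\<chi> i. to_fract ((\<Sum>j\<in>UNIV. smult (Q $ i $ j) (C $ j)) + [:b $ i:]))"
proof -
  have "f 0 = b" using assms[of 0] by simp
  moreover have "(\<lambda>v. f v - f 0) = (*v) Q" using assms by (auto simp: fun_eq_iff)
  ultimately show ?thesis by (simp add: map_curve_def)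
qed

definition cyclide :: "real \<Rightarrow> real \<Rightarrow> (real ^ 3) set"
  where "cyclide c g = {v. let x = v $ 1; y = v $ 2; z = v $ 3 in
           (x + c) * (x\<^sup>2 + y\<^sup>2 + z\<^sup>2) + (y\<^sup>2 - z\<^sup>2) * g - (g\<^sup>2 + c\<^sup>2) * x + (g\<^sup>2 - c\<^sup>2) * c = 0}"

definition spine1 :: "real \<Rightarrow> real poly ^ 3"
  where "spine1 g = vector [smult g [:- 1/2, 0, 1:], smult g [:0, 2:], 0]"

definition spine2 :: "real \<Rightarrow> real poly ^ 3"
  where "spine2 g = vector [smult g [:1/2, 0, - 1:], 0, smult g [:0, 2:]]"

definition radius1 :: "real \<Rightarrow> real \<Rightarrow> real poly"
  where "radius1 c g = [:c:] + smult g [:1/2, 0, 1:]"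

definition radius2 :: "real \<Rightarrow> real \<Rightarrow> real poly"
  where "radius2 c g = [:c:] - smult g [:1/2, 0, 1:]"

lemma poly_spine1: "(\<chi> i. poly (spine1 g $ i) t) = g *\<^sub>R vector [t\<^sup>2 - 1/2, 2 * t, 0]"
  by (simp add: spine1_def vec_eq_iff forall_3 power2_eq_square algebra_simps)

lemma poly_spine2: "(\<chi> i. poly (spine2 g $ i) t) = g *\<^sub>R vector [1/2 - t\<^sup>2, 0, 2 * t]"
  by (simp add: spine2_def vec_eq_iff forall_3 power2_eq_square algebra_simps)

lemma poly_radius1: "poly (radius1 c g) t = c + g * (t\<^sup>2 + 1/2)"
  by (simp add: radius1_def power2_eq_square algebra_simps)

lemma poly_radius2: "poly (radius2 c g) t = c - g * (t\<^sup>2 + 1/2)"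
  by (simp add: radius2_def power2_eq_square algebra_simps)

text \<open>The point \<open>v\<close> lies on the sphere with parameter \<open>t\<close> of the first or second family iff a
  polynomial of degree at most two vanishes at \<open>t\<close>. The discriminant of this polynomial is, up to
  the factor \<open>\<plusminus>8g\<close>, the polynomial that defines the cyclide, so the cyclide consists of the
  points with a double root in \<open>\<real> \<union> {\<infinity>}\<close> and is the envelope of either family.\<close>

lemma cyclide_envelope1:
  fixes c g t :: real and v :: "real ^ 3"
  defines "p \<equiv> 2 * g * (g - c - v $ 1)" and "q \<equiv> - 4 * g * v $ 2"
    and "r \<equiv> (norm v)\<^sup>2 + g * v $ 1 - c\<^sup>2 - c * g"
  shows "(norm (v - (\<chi> i. poly (spine1 g $ i) t)))\<^sup>2 - (poly (radius1 c g) t)\<^sup>2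
           = p * t\<^sup>2 + q * t + r"
    and "g \<noteq> 0 \<Longrightarrow> v \<in> cyclide c g \<longleftrightarrow> q\<^sup>2 - 4 * p * r = 0"
proof -
  have n: "(norm w)\<^sup>2 = (w $ 1)\<^sup>2 + (w $ 2)\<^sup>2 + (w $ 3)\<^sup>2" for w :: "real ^ 3"
    unfolding power2_norm_eq_inner inner_vec_def sum_3 by (simp add: power2_eq_square)
  show "(norm (v - (\<chi> i. poly (spine1 g $ i) t)))\<^sup>2 - (poly (radius1 c g) t)\<^sup>2
           = p * t\<^sup>2 + q * t + r"
    unfolding poly_spine1 poly_radius1 n p_def q_def r_def
    by (simp add: field_simps power2_eq_square)
  define F where "F = (v $ 1 + c) * ((v $ 1)\<^sup>2 + (v $ 2)\<^sup>2 + (v $ 3)\<^sup>2)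
    + ((v $ 2)\<^sup>2 - (v $ 3)\<^sup>2) * g - (g\<^sup>2 + c\<^sup>2) * v $ 1 + (g\<^sup>2 - c\<^sup>2) * c"
  have "q\<^sup>2 - 4 * p * r = 8 * g * F"
    unfolding n p_def q_def r_def F_def by algebra
  then show "v \<in> cyclide c g \<longleftrightarrow> q\<^sup>2 - 4 * p * r = 0" if "g \<noteq> 0"
    using that by (simp add: cyclide_def F_def Let_def)
qed

lemma cyclide_envelope2:
  fixes c g t :: real and v :: "real ^ 3"
  defines "p \<equiv> 2 * g * (g + c + v $ 1)" and "q \<equiv> - 4 * g * v $ 3"
    and "r \<equiv> (norm v)\<^sup>2 - g * v $ 1 - c\<^sup>2 + c * g"
  shows "(norm (v - (\<chi> i. poly (spine2 g $ i) t)))\<^sup>2 - (poly (radius2 c g) t)\<^sup>2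
           = p * t\<^sup>2 + q * t + r"
    and "g \<noteq> 0 \<Longrightarrow> v \<in> cyclide c g \<longleftrightarrow> q\<^sup>2 - 4 * p * r = 0"
proof -
  have n: "(norm w)\<^sup>2 = (w $ 1)\<^sup>2 + (w $ 2)\<^sup>2 + (w $ 3)\<^sup>2" for w :: "real ^ 3"
    unfolding power2_norm_eq_inner inner_vec_def sum_3 by (simp add: power2_eq_square)
  show "(norm (v - (\<chi> i. poly (spine2 g $ i) t)))\<^sup>2 - (poly (radius2 c g) t)\<^sup>2
           = p * t\<^sup>2 + q * t + r"
    unfolding poly_spine2 poly_radius2 n p_def q_def r_def
    by (simp add: field_simps power2_eq_square)
  define F where "F = (v $ 1 + c) * ((v $ 1)\<^sup>2 + (v $ 2)\<^sup>2 + (v $ 3)\<^sup>2)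
    + ((v $ 2)\<^sup>2 - (v $ 3)\<^sup>2) * g - (g\<^sup>2 + c\<^sup>2) * v $ 1 + (g\<^sup>2 - c\<^sup>2) * c"
  have "q\<^sup>2 - 4 * p * r = - 8 * g * F"
    unfolding n p_def q_def r_def F_def by algebra
  then show "v \<in> cyclide c g \<longleftrightarrow> q\<^sup>2 - 4 * p * r = 0" if "g \<noteq> 0"
    using that by (simp add: cyclide_def F_def Let_def)
qed

definition condA :: "real \<Rightarrow> real \<Rightarrow> (real ^ 3 \<Rightarrow> real ^ 3) \<Rightarrow> ratfun \<Rightarrow> ratfun \<Rightarrow> bool"
  where "condA c g f \<phi>\<^sub>1 \<phi>\<^sub>2 \<longleftrightarrow>
     map_curve f (spine1 g) = subst_curve (spine1 g) \<phi>\<^sub>1 \<and>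
     map_curve f (spine2 g) = subst_curve (spine2 g) \<phi>\<^sub>2 \<and>
     (to_fract (radius1 c g))\<^sup>2 = (subst_fun (radius1 c g) \<phi>\<^sub>1)\<^sup>2 \<and>
     (to_fract (radius2 c g))\<^sup>2 = (subst_fun (radius2 c g) \<phi>\<^sub>2)\<^sup>2"

definition condB :: "real \<Rightarrow> real \<Rightarrow> (real ^ 3 \<Rightarrow> real ^ 3) \<Rightarrow> ratfun \<Rightarrow> ratfun \<Rightarrow> bool"
  where "condB c g f \<phi>\<^sub>1 \<phi>\<^sub>2 \<longleftrightarrow>
     map_curve f (spine1 g) = subst_curve (spine2 g) \<phi>\<^sub>1 \<and>
     map_curve f (spine2 g) = subst_curve (spine1 g) \<phi>\<^sub>2 \<and>
     (to_fract (radius1 c g))\<^sup>2 = (subst_fun (radius2 c g) \<phi>\<^sub>1)\<^sup>2 \<and>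
     (to_fract (radius2 c g))\<^sup>2 = (subst_fun (radius1 c g) \<phi>\<^sub>2)\<^sup>2"

definition cases_a_d :: "(ratfun \<times> ratfun \<times> (real ^ 3 \<Rightarrow> real ^ 3)) set"
  where "cases_a_d = {
     (  ratvar,   ratvar, \<lambda>v. vector [v $ 1,    v $ 2,    v $ 3]),
     (  ratvar, - ratvar, \<lambda>v. vector [v $ 1,    v $ 2, - (v $ 3)]),
     (- ratvar,   ratvar, \<lambda>v. vector [v $ 1, - (v $ 2),   v $ 3]),
     (- ratvar, - ratvar, \<lambda>v. vector [v $ 1, - (v $ 2), - (v $ 3)])}"

definition cases_i_l :: "(ratfun \<times> ratfun \<times> (real ^ 3 \<Rightarrow> real ^ 3)) set"
  where "cases_i_l = {
     (  ratvar,   ratvar, \<lambda>v. vector [- (v $ 1),    v $ 3,    v $ 2]),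
     (- ratvar, - ratvar, \<lambda>v. vector [- (v $ 1), - (v $ 3), - (v $ 2)]),
     (  ratvar, - ratvar, \<lambda>v. vector [- (v $ 1), - (v $ 3),   v $ 2]),
     (- ratvar,   ratvar, \<lambda>v. vector [- (v $ 1),    v $ 3, - (v $ 2)])}"

definition case_maps ::
    "(ratfun \<times> ratfun \<times> (real ^ 3 \<Rightarrow> real ^ 3)) set \<Rightarrow> (real ^ 3 \<Rightarrow> real ^ 3) set"
  where "case_maps K = {f. \<exists>\<phi>\<^sub>1 \<phi>\<^sub>2. (\<phi>\<^sub>1, \<phi>\<^sub>2, f) \<in> K}"

definition symmetries :: "(real ^ 3) set \<Rightarrow> (real ^ 3 \<Rightarrow> real ^ 3) set"
  where "symmetries S = {f. isometry3 f \<and> f ` S = S}"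

definition symmetry_group :: "(real ^ 3) set \<Rightarrow> (real ^ 3 \<Rightarrow> real ^ 3) monoid"
  where "symmetry_group S = \<lparr>carrier = symmetries S, monoid.mult = (\<circ>), one = id\<rparr>"

definition klein_four_group :: "(int \<times> int) monoid"
  where "klein_four_group = integer_mod_group 2 \<times>\<times> integer_mod_group 2"

text \<open>The dihedral group of order \<open>2n\<close>: the pair \<open>(k, s)\<close> stands for the rotation \<open>\<rho>\<^sup>k\<close> if \<open>s\<close> is
  false and for the reflection \<open>\<rho>\<^sup>k\<sigma>\<close> if \<open>s\<close> is true, where \<open>\<sigma>\<rho> = \<rho>\<^sup>-\<^sup>1\<sigma>\<close>.\<close>

definition dihedral_group :: "nat \<Rightarrow> (int \<times> bool) monoid"
  where "dihedral_group n = \<lparr>carrier = {0..<int n} \<times> UNIV,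
           monoid.mult = (\<lambda>(k, s) (l, s'). ((if s then k - l else k + l) mod int n, s \<noteq> s')),
           one = (0, False)\<rparr>"

lemma order_dihedral_group: "order (dihedral_group n) = 2 * n"
  by (simp add: dihedral_group_def order_def card_cartesian_product)

lemma group_dihedral_group:
  assumes "n > 0"
  shows "group (dihedral_group n)"
proof (rule groupI, goal_cases)
  case (3 x y z)
  then show ?case by (auto simp: dihedral_group_def mod_simps algebra_simps split: if_splits)
next
  case (5 x)
  obtain k s where x: "x = (k, s)" by force
  with 5 have k: "0 \<le> k" "k < int n" by (auto simp: dihedral_group_def)
  show ?case
    using k assms by (intro bexI[of _ "if s then x else ((- k) mod int n, False)"])
      (auto simp: dihedral_group_def x mod_simps)
qed (use assms in \<open>auto simp: dihedral_group_def split: if_splits\<close>)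

end

theory Submission
  imports Defs
begin

text \<open>
  The radii decide the reparametrizations. Both radius functions are even quadratics
  with leading coefficients \<open>\<plusminus>g\<close>, so equality of squared radii says \<open>\<phi>\<^sup>2 = \<plusminus>t\<^sup>2 + k\<close> for a constant
  \<open>k\<close>. The square of a Moebius transformation has this form only if it is \<open>t\<^sup>2\<close>
  (\<open>moebius_square_quadratic\<close>), so \<open>\<phi> = \<plusminus>t\<close>. Comparing constant terms then imposes nothing when the two
  families are preserved, and \<open>c = 0\<close> when they are exchanged (\<open>even_quadratic_square_subst_iff\<close>).
  Given \<open>\<phi>\<^sub>1 = \<plusminus>t\<close> and \<open>\<phi>\<^sub>2 = \<plusminus>t\<close>, the linear part of the isometry is known on the directions of the
  axis and of the vertex tangent of each spine parabola (\<open>map_parabola_eq_iff\<close>). These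
  vectors span the space, and the constant terms force the isometry to fix the origin.

  A symmetry of the surface is not known beforehand to act on the two families of spheres,
  so it is determined from lines instead. With \<open>u = x + c\<close> the equation of the cyclide is
  \<open>(u + g) y\<^sup>2 + (u - g) z\<^sup>2 + (u - 2c) (u\<^sup>2 - g\<^sup>2) = 0\<close>, which exhibits the lines \<open>u = g, y = 0\<close> and
  \<open>u = -g, z = 0\<close> in the surface. Along any line in the surface the cubic vanishes identically, and its
  two highest coefficients say that the line is horizontal, at a height \<open>u\<close> prescribed by its direction
  (\<open>line_in_cyclide\<close>). Applied to the images of the two lines under a symmetry, this leaves
  only the sign changes of \<open>y\<close> and \<open>z\<close>, and the maps that also reflect \<open>u\<close> in \<open>0\<close> and exchange the
  \<open>y\<close>- and \<open>z\<close>-axes. Reflecting \<open>u\<close> replaces the factor \<open>u - 2c\<close> by \<open>u + 2c\<close>, so it preserves the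
  surface only if \<open>c = 0\<close> (\<open>isometry_of_cyclide_cases\<close>).

  The sign changes form a Klein four group. Together with the exchanges, which compose with
  them as signed permutations of the \<open>yz\<close>-plane do, they form the symmetry group of a square.
\<close>

(* Both formal power series and vectors are indexed by $; here it always means vectors. *)
no_notation fps_nth (infixl \<open>$\<close> 75)

section \<open>Reparametrizations determined by the radius functions\<close>

lemma subst_fun_to_fract: "subst_fun p (to_fract q) = to_fract (pcompose p q)"
  by (induction p) (simp_all add: subst_fun_def pcompose_pCons ratconst_def map_poly_pCons)

lemma minus_ratvar: "- ratvar = to_fract [:0, -1:]"
proof -
  have "- ratvar = to_fract (- [:0, 1:])" unfolding ratvar_def by (simp only: to_fract_uminus)
  then show ?thesis by simp
qed

text \<open>Clearing denominators in \<open>\<phi>\<^sup>2 = s t\<^sup>2 + k\<close>, the coefficient of \<open>t\<^sup>4\<close> shows that \<open>\<phi>\<close> has constant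
  denominator. The linear coefficient then leaves \<open>\<phi>\<close> a multiple of \<open>t\<close>, and a real square excludes
  \<open>s = -1\<close>.\<close>

lemma moebius_square_quadratic:
  assumes "moebius_transf \<phi>" and sq: "\<phi>\<^sup>2 = to_fract [:k, 0, s:]" and "\<bar>s\<bar> = 1"
  shows "s = 1 \<and> k = 0 \<and> (\<phi> = ratvar \<or> \<phi> = - ratvar)"
proof -
  obtain \<alpha> \<beta> \<gamma> \<delta> :: real where det: "\<alpha> * \<delta> - \<beta> * \<gamma> \<noteq> 0"
    and \<phi>: "\<phi> = Fraction_Field.Fract [:\<beta>, \<alpha>:] [:\<delta>, \<gamma>:]"
    using assms(1) unfolding moebius_transf_def by blast
  have nz: "[:\<delta>, \<gamma>:] \<noteq> 0" using det by auto
  have nz2: "[:\<delta>, \<gamma>:] * [:\<delta>, \<gamma>:] \<noteq> 0" using nz by (metis mult_eq_0_iff)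
  have "Fraction_Field.Fract ([:\<beta>, \<alpha>:] * [:\<beta>, \<alpha>:]) ([:\<delta>, \<gamma>:] * [:\<delta>, \<gamma>:])
      = Fraction_Field.Fract [:k, 0, s:] 1"
    using sq unfolding \<phi> power2_eq_square mult_fract to_fract_def .
  then have "[:\<beta>, \<alpha>:] * [:\<beta>, \<alpha>:] * 1 = [:k, 0, s:] * ([:\<delta>, \<gamma>:] * [:\<delta>, \<gamma>:])"
    using eq_fract(1)[OF nz2, of 1] by (metis one_neq_zero)
  then have c: "\<beta> * \<beta> = k * (\<delta> * \<delta>)" "2 * (\<alpha> * \<beta>) = k * (2 * (\<gamma> * \<delta>))"
      "\<alpha> * \<alpha> = k * (\<gamma> * \<gamma>) + s * (\<delta> * \<delta>)" "s * (\<gamma> * \<gamma>) = 0"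
    by (auto simp: algebra_simps)
  have s: "s = 1 \<or> s = -1" using \<open>\<bar>s\<bar> = 1\<close> by linarith
  then have \<gamma>: "\<gamma> = 0" using c(4) by auto
  then have \<alpha>\<delta>: "\<alpha> \<noteq> 0" "\<delta> \<noteq> 0" using det by auto
  have \<beta>: "\<beta> = 0" using c(2) \<gamma> \<alpha>\<delta> by simp
  have k: "k = 0" using c(1) \<beta> \<alpha>\<delta> by simp
  have "s = 1" 
  proof (rule ccontr)
    assume "s \<noteq> 1"
    then have "\<alpha> * \<alpha> = - (\<delta> * \<delta>)" using s c(3) \<gamma> by simp
    then show False using \<alpha>\<delta> by (smt (verit) not_real_square_gt_zero)
  qed
  then have "\<phi>\<^sup>2 = ratvar\<^sup>2"
    using sq k by (simp add: ratvar_def power2_eq_square flip: to_fract_mult)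
  then show ?thesis using \<open>s = 1\<close> k by (simp add: power2_eq_iff)
qed

text \<open>Equal squares in a field differ by a sign. For each sign the equation can be solved for \<open>\<phi>\<^sup>2\<close>,
  because \<open>b\<close> is invertible.\<close>

lemma even_quadratic_square_subst_iff:
  assumes "moebius_transf \<phi>" and b: "b \<noteq> 0" "\<bar>b'\<bar> = \<bar>b\<bar>"
  shows "(to_fract [:a', 0, b':])\<^sup>2 = (subst_fun [:a, 0, b:] \<phi>)\<^sup>2 \<longleftrightarrow>
    (\<phi> = ratvar \<or> \<phi> = - ratvar) \<and> (a' = a \<and> b' = b \<or> a' = - a \<and> b' = - b)"
proof -
  have sub: "subst_fun [:a, 0, b:] \<phi> = to_fract [:a:] + to_fract [:b:] * \<phi>\<^sup>2"
    using b by (simp add: subst_fun_def map_poly_pCons ratconst_def power2_eq_square algebra_simps)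
  have main: "(\<phi> = ratvar \<or> \<phi> = - ratvar) \<and> a' = r * a \<and> b' = r * b"
    if r: "r = 1 \<or> r = -1" and eq: "to_fract [:r * a', 0, r * b':] = subst_fun [:a, 0, b:] \<phi>" for r
  proof -
    have "to_fract [:b:] * \<phi>\<^sup>2 = to_fract [:r * a' - a, 0, r * b':]"
      using eq unfolding sub by (simp add: algebra_simps flip: to_fract_diff to_fract_add)
        (smt (verit) add_diff_cancel_left' diff_pCons diff_zero to_fract_diff)
    then have "to_fract [:1 / b:] * (to_fract [:b:] * \<phi>\<^sup>2)
      = to_fract [:(r * a' - a) / b, 0, r * b' / b:]"
      by (simp flip: to_fract_mult)
    moreover have "to_fract [:1 / b:] * to_fract [:b:] = (1 :: ratfun)"
      using b by (simp flip: to_fract_mult one_pCons)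
    ultimately have sq: "\<phi>\<^sup>2 = to_fract [:(r * a' - a) / b, 0, r * b' / b:]"
      by (simp flip: mult.assoc)
    have "\<bar>r * b' / b\<bar> = 1" using r b by (auto simp: abs_mult)
    from moebius_square_quadratic[OF assms(1) sq this] show ?thesis
      using r b by (auto simp: field_simps)
  qed
  have ev: "subst_fun [:a, 0, b:] \<phi> = to_fract [:a, 0, b:]" if "\<phi> = ratvar \<or> \<phi> = - ratvar"
    using that unfolding minus_ratvar unfolding ratvar_def
    by (auto simp: subst_fun_to_fract pcompose_pCons)
  have neg: "- to_fract [:x, 0, y:] = to_fract [:- x, 0, - y:]" for x y :: real
    by (simp flip: to_fract_uminus)
  show ?thesis
  proof
    assume "(to_fract [:a', 0, b':])\<^sup>2 = (subst_fun [:a, 0, b:] \<phi>)\<^sup>2"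
    then have "to_fract [:a', 0, b':] = subst_fun [:a, 0, b:] \<phi> \<or>
        - to_fract [:a', 0, b':] = subst_fun [:a, 0, b:] \<phi>"
      by (metis power2_eq_iff minus_minus)
    then show "(\<phi> = ratvar \<or> \<phi> = - ratvar) \<and> (a' = a \<and> b' = b \<or> a' = - a \<and> b' = - b)"
      using main[of 1] main[of "-1"] unfolding neg by auto
  next
    assume *: "(\<phi> = ratvar \<or> \<phi> = - ratvar) \<and> (a' = a \<and> b' = b \<or> a' = - a \<and> b' = - b)"
    then show "(to_fract [:a', 0, b':])\<^sup>2 = (subst_fun [:a, 0, b:] \<phi>)\<^sup>2"
      using ev by (auto simp flip: neg)
  qed
qed

lemma radius1_coeffs: "radius1 c g = [:c + g / 2, 0, g:]"
  by (simp add: radius1_def)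

lemma radius2_coeffs: "radius2 c g = [:c - g / 2, 0, - g:]"
  by (simp add: radius2_def)

section \<open>The isometries of the classification\<close>

definition axis_flip :: "real \<Rightarrow> real \<Rightarrow> real ^ 3 \<Rightarrow> real ^ 3"
  where "axis_flip d e v = vector [v $ 1, d * v $ 2, e * v $ 3]"

definition axis_swap :: "real \<Rightarrow> real \<Rightarrow> real ^ 3 \<Rightarrow> real ^ 3"
  where "axis_swap d e v = vector [- (v $ 1), e * v $ 3, d * v $ 2]"

lemma axis_flip_swap_comp:
  "axis_flip d e \<circ> axis_flip d' e' = axis_flip (d * d') (e * e')"
  "axis_flip d e \<circ> axis_swap d' e' = axis_swap (e * d') (d * e')"
  "axis_swap d e \<circ> axis_flip d' e' = axis_swap (d * d') (e * e')"
  "axis_swap d e \<circ> axis_swap d' e' = axis_flip (e * d') (d * e')"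
  by (simp_all add: axis_flip_def axis_swap_def fun_eq_iff mult.assoc)

lemma axis_flip_swap_eq_iff:
  "axis_flip d e = axis_flip d' e' \<longleftrightarrow> d = d' \<and> e = e'"
  "axis_swap d e = axis_swap d' e' \<longleftrightarrow> d = d' \<and> e = e'"
  "axis_flip d e \<noteq> axis_swap d' e'"
  "axis_swap d e \<noteq> axis_flip d' e'"
proof -
  have *: "axis_flip d e (vector [1, 1, 1]) = vector [1, d, e]"
    "axis_swap d e (vector [1, 1, 1]) = vector [-1, e, d]" for d e
    by (simp_all add: axis_flip_def axis_swap_def)
  have **: "vector [a, b, c] = (vector [a', b', c'] :: real ^ 3) \<longleftrightarrow> a = a' \<and> b = b' \<and> c = c'"
    for a b c a' b' c' by (simp add: vec_eq_iff forall_3)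
  show "axis_flip d e = axis_flip d' e' \<longleftrightarrow> d = d' \<and> e = e'"
    "axis_swap d e = axis_swap d' e' \<longleftrightarrow> d = d' \<and> e = e'"
    "axis_flip d e \<noteq> axis_swap d' e'" "axis_swap d e \<noteq> axis_flip d' e'"
    by (metis * **, metis * **, metis * ** one_neq_neg_one, metis * ** one_neq_neg_one)
qed

lemma isometry3_axis_flip:
  assumes "d\<^sup>2 = 1" "e\<^sup>2 = 1"
  shows "isometry3 (axis_flip d e)"
  unfolding isometry3_def
  using assms
  by (intro exI[of _ "vector [vector [1, 0, 0], vector [0, d, 0], vector [0, 0, e]]"] exI[of _ 0])
    (simp add: orthogonal_matrix_def axis_flip_def matrix_vector_mult_def matrix_matrix_mult_def
      transpose_def mat_def vec_eq_iff forall_3 sum_3 power2_eq_square)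

lemma isometry3_axis_swap:
  assumes "d\<^sup>2 = 1" "e\<^sup>2 = 1"
  shows "isometry3 (axis_swap d e)"
  unfolding isometry3_def
  using assms
  by (intro exI[of _ "vector [vector [-1, 0, 0], vector [0, 0, e], vector [0, d, 0]]"] exI[of _ 0])
    (simp add: orthogonal_matrix_def axis_swap_def matrix_vector_mult_def matrix_matrix_mult_def
      transpose_def mat_def vec_eq_iff forall_3 sum_3 power2_eq_square)

section \<open>Isometries acting on the spine curves\<close>

text \<open>The parabola \<open>g ((t\<^sup>2 - 1/2) u + 2 t w)\<close>. Both spine curves have this form, with \<open>u = e\<^sub>1\<close>,
  \<open>w = e\<^sub>2\<close> and \<open>u = -e\<^sub>1\<close>, \<open>w = e\<^sub>3\<close>, so that preserving and exchanging them can be treated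
  alike.\<close>

definition parabola :: "real \<Rightarrow> real ^ 3 \<Rightarrow> real ^ 3 \<Rightarrow> real poly ^ 3"
  where "parabola g u w = (\<chi> i. smult g [:- (u $ i) / 2, 2 * w $ i, u $ i:])"

lemma spine1_parabola: "spine1 g = parabola g (axis 1 1) (axis 2 1)"
  by (simp add: spine1_def parabola_def vec_eq_iff forall_3 axis_def)

lemma spine2_parabola: "spine2 g = parabola g (- axis 1 1) (axis 3 1)"
  by (simp add: spine2_def parabola_def vec_eq_iff forall_3 axis_def)

text \<open>Here \<open>e = \<plusminus>1\<close>, so \<open>\<phi> = e t\<close> is one of the two possible reparametrizations. The coefficients of
  \<open>t\<^sup>2\<close> and \<open>t\<close> give the images of \<open>u\<close> and \<open>w\<close> under the linear part; since the constant term is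
  \<open>-1/2\<close> times the coefficient of \<open>t\<^sup>2\<close>, it leaves no room for a translation.\<close>

lemma map_parabola_eq_iff:
  assumes f: "isometry3 f" and g: "g \<noteq> 0" and e: "e\<^sup>2 = 1"
  shows "map_curve f (parabola g u w) = subst_curve (parabola g u' w') (to_fract [:0, e:]) \<longleftrightarrow>
    f 0 = 0 \<and> f u = u' \<and> f w = e *\<^sub>R w'"
proof -
  obtain Q b where Q: "\<And>v. f v = Q *v v + b" using f unfolding isometry3_def by blast
  have 1: "map_curve f (parabola g u w) = (\<chi> i. to_fract
      [:b $ i - g * (Q *v u) $ i / 2, 2 * g * (Q *v w) $ i, g * (Q *v u) $ i:])"
    unfolding map_curve_affine[OF Q]
    by (simp add: parabola_def vec_eq_iff forall_3 sum_3 matrix_vector_mult_def field_simps)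
  have 2: "subst_curve (parabola g u' w') (to_fract [:0, e:]) = (\<chi> i. to_fract
      [:- g * u' $ i / 2, 2 * g * e * w' $ i, g * u' $ i:])"
    using e by (simp add: subst_curve_def parabola_def vec_eq_iff subst_fun_to_fract pcompose_pCons
        power2_eq_square algebra_simps)
  have "map_curve f (parabola g u w) = subst_curve (parabola g u' w') (to_fract [:0, e:]) \<longleftrightarrow>
      (\<forall>i. b $ i - g * (Q *v u) $ i / 2 = - g * u' $ i / 2 \<and>
        (Q *v w) $ i = e * w' $ i \<and> (Q *v u) $ i = u' $ i)"
    unfolding 1 2 using g by (simp add: vec_eq_iff)
  also have "\<dots> \<longleftrightarrow> (\<forall>i. b $ i = 0 \<and> (Q *v u) $ i = u' $ i \<and> (Q *v w) $ i = e * w' $ i)"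
    by (intro arg_cong[of _ _ All] ext) auto
  also have "\<dots> \<longleftrightarrow> b = 0 \<and> Q *v u = u' \<and> Q *v w = e *\<^sub>R w'"
    by (auto simp: vec_eq_iff)
  also have "\<dots> \<longleftrightarrow> f 0 = 0 \<and> f u = u' \<and> f w = e *\<^sub>R w'"
    by (auto simp: Q)
  finally show ?thesis .
qed

lemma isometry3_fixing_0_expand:
  assumes "isometry3 f" "f 0 = 0"
  shows "f v = v $ 1 *\<^sub>R f (axis 1 1) + v $ 2 *\<^sub>R f (axis 2 1) + v $ 3 *\<^sub>R f (axis 3 1)"
proof -
  obtain Q b where Q: "\<And>v. f v = Q *v v + b" using assms(1) unfolding isometry3_def by blast
  have "b = 0" using assms(2) Q[of 0] by simp
  then show ?thesis
    by (simp add: Q vec_eq_iff forall_3 matrix_vector_mult_def sum_3 axis_def)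
qed

lemma isometry3_fixing_0_uminus:
  assumes "isometry3 f" "f 0 = 0"
  shows "f (- v) = - f v"
  unfolding isometry3_fixing_0_expand[OF assms, of "- v"] isometry3_fixing_0_expand[OF assms, of v]
  by simp

lemma isometry3_eq_flip_iff:
  assumes "isometry3 f"
  shows "f = axis_flip d e \<longleftrightarrow> f 0 = 0 \<and> f (axis 1 1) = axis 1 1 \<and>
      f (axis 2 1) = d *\<^sub>R axis 2 1 \<and> f (axis 3 1) = e *\<^sub>R axis 3 1" (is "?l \<longleftrightarrow> ?r")
proof
  assume ?r
  then have "f v = axis_flip d e v" for v
    using isometry3_fixing_0_expand[OF assms, of v]
    by (simp add: axis_flip_def vec_eq_iff forall_3 axis_def)
  then show ?l by blast
qed (simp add: axis_flip_def vec_eq_iff forall_3 axis_def)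

lemma isometry3_eq_swap_iff:
  assumes "isometry3 f"
  shows "f = axis_swap d e \<longleftrightarrow> f 0 = 0 \<and> f (axis 1 1) = - axis 1 1 \<and>
      f (axis 2 1) = d *\<^sub>R axis 3 1 \<and> f (axis 3 1) = e *\<^sub>R axis 2 1" (is "?l \<longleftrightarrow> ?r")
proof
  assume ?r
  then have "f v = axis_swap d e v" for v
    using isometry3_fixing_0_expand[OF assms, of v]
    by (simp add: axis_swap_def vec_eq_iff forall_3 axis_def)
  then show ?l by blast
qed (simp add: axis_swap_def vec_eq_iff forall_3 axis_def)

lemma mem_cases_a_d_iff:
  "(\<phi>\<^sub>1, \<phi>\<^sub>2, f) \<in> cases_a_d \<longleftrightarrow>
    (\<exists>d\<in>{1, -1}. \<exists>e\<in>{1, -1}. \<phi>\<^sub>1 = to_fract [:0, d:] \<and> \<phi>\<^sub>2 = to_fract [:0, e:] \<and>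
      f = axis_flip d e)"
  unfolding cases_a_d_def axis_flip_def minus_ratvar unfolding ratvar_def by auto

lemma mem_cases_i_l_iff:
  "(\<phi>\<^sub>1, \<phi>\<^sub>2, f) \<in> cases_i_l \<longleftrightarrow>
    (\<exists>d\<in>{1, -1}. \<exists>e\<in>{1, -1}. \<phi>\<^sub>1 = to_fract [:0, d:] \<and> \<phi>\<^sub>2 = to_fract [:0, e:] \<and>
      f = axis_swap d e)"
  unfolding cases_i_l_def axis_swap_def minus_ratvar unfolding ratvar_def by auto

lemma ratvar_or_uminus_iff:
  "\<phi> = ratvar \<or> \<phi> = - ratvar \<longleftrightarrow> (\<exists>e\<in>{1, -1}. \<phi> = to_fract [:0, e:])"
  unfolding minus_ratvar unfolding ratvar_def by auto

lemma condA_iff: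
  assumes g: "g \<noteq> 0" and f: "isometry3 f" and m: "moebius_transf \<phi>\<^sub>1" "moebius_transf \<phi>\<^sub>2"
  shows "condA c g f \<phi>\<^sub>1 \<phi>\<^sub>2 \<longleftrightarrow> (\<phi>\<^sub>1, \<phi>\<^sub>2, f) \<in> cases_a_d"
proof -
  have rad: "(to_fract (radius1 c g))\<^sup>2 = (subst_fun (radius1 c g) \<phi>\<^sub>1)\<^sup>2 \<longleftrightarrow>
        (\<exists>e\<in>{1, -1}. \<phi>\<^sub>1 = to_fract [:0, e:])"
      "(to_fract (radius2 c g))\<^sup>2 = (subst_fun (radius2 c g) \<phi>\<^sub>2)\<^sup>2 \<longleftrightarrow>
        (\<exists>e\<in>{1, -1}. \<phi>\<^sub>2 = to_fract [:0, e:])"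
    unfolding radius1_coeffs radius2_coeffs ratvar_or_uminus_iff[symmetric]
    using g by (simp_all add: even_quadratic_square_subst_iff m)
  have curves: "map_curve f (spine1 g) = subst_curve (spine1 g) (to_fract [:0, d:]) \<and>
      map_curve f (spine2 g) = subst_curve (spine2 g) (to_fract [:0, e:]) \<longleftrightarrow>
      f = axis_flip d e" if "d\<^sup>2 = 1" "e\<^sup>2 = 1" for d e
    unfolding spine1_parabola spine2_parabola map_parabola_eq_iff[OF f g that(1)]
      map_parabola_eq_iff[OF f g that(2)] isometry3_eq_flip_iff[OF f]
    using isometry3_fixing_0_uminus[OF f] by auto
  show ?thesis
    unfolding condA_def mem_cases_a_d_iff rad using curves[of 1 1] curves[of 1 "-1"]
      curves[of "-1" 1] curves[of "-1" "-1"] by auto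
qed

lemma condB_iff:
  assumes g: "g \<noteq> 0" and f: "isometry3 f" and m: "moebius_transf \<phi>\<^sub>1" "moebius_transf \<phi>\<^sub>2"
  shows "condB c g f \<phi>\<^sub>1 \<phi>\<^sub>2 \<longleftrightarrow> c = 0 \<and> (\<phi>\<^sub>1, \<phi>\<^sub>2, f) \<in> cases_i_l"
proof -
  have rad: "(to_fract (radius1 c g))\<^sup>2 = (subst_fun (radius2 c g) \<phi>\<^sub>1)\<^sup>2 \<longleftrightarrow>
        c = 0 \<and> (\<exists>e\<in>{1, -1}. \<phi>\<^sub>1 = to_fract [:0, e:])"
      "(to_fract (radius2 c g))\<^sup>2 = (subst_fun (radius1 c g) \<phi>\<^sub>2)\<^sup>2 \<longleftrightarrow>
        c = 0 \<and> (\<exists>e\<in>{1, -1}. \<phi>\<^sub>2 = to_fract [:0, e:])"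
    unfolding radius1_coeffs radius2_coeffs ratvar_or_uminus_iff[symmetric]
    using g by (auto simp add: even_quadratic_square_subst_iff m)
  have curves: "map_curve f (spine1 g) = subst_curve (spine2 g) (to_fract [:0, d:]) \<and>
      map_curve f (spine2 g) = subst_curve (spine1 g) (to_fract [:0, e:]) \<longleftrightarrow>
      f = axis_swap d e" if "d\<^sup>2 = 1" "e\<^sup>2 = 1" for d e
    unfolding spine1_parabola spine2_parabola map_parabola_eq_iff[OF f g that(1)]
      map_parabola_eq_iff[OF f g that(2)] isometry3_eq_swap_iff[OF f]
    using isometry3_fixing_0_uminus[OF f] by auto
  show ?thesis
    unfolding condB_def mem_cases_i_l_iff rad using curves[of 1 1] curves[of 1 "-1"]
      curves[of "-1" 1] curves[of "-1" "-1"] by auto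
qed

section \<open>Symmetries of the cyclide\<close>

lemma mem_cyclide_iff:
  "v \<in> cyclide c g \<longleftrightarrow> (v $ 1 + c + g) * (v $ 2)\<^sup>2 + (v $ 1 + c - g) * (v $ 3)\<^sup>2
     + (v $ 1 - c) * ((v $ 1 + c)\<^sup>2 - g\<^sup>2) = 0"
  by (simp add: cyclide_def Let_def power2_eq_square algebra_simps)

text \<open>On a line in the cyclide the cubic restricts to a polynomial in the line parameter \<open>s\<close> that is
  identically zero. The leading form of the cubic is \<open>x (x\<^sup>2 + y\<^sup>2 + z\<^sup>2)\<close>, so the coefficient of \<open>s\<^sup>3\<close> is
  \<open>d\<^sub>1 |d|\<^sup>2\<close> and \<open>d\<close> is orthogonal to the \<open>x\<close>-axis; then the coefficient of \<open>s\<^sup>2\<close> is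
  \<open>(u + g) d\<^sub>2\<^sup>2 + (u - g) d\<^sub>3\<^sup>2\<close> with \<open>u = p\<^sub>1 + c\<close>.\<close>

lemma line_in_cyclide:
  fixes p d :: "real ^ 3"
  assumes line: "\<And>s. p + s *\<^sub>R d \<in> cyclide c g"
    and unit: "(d $ 1)\<^sup>2 + (d $ 2)\<^sup>2 + (d $ 3)\<^sup>2 = 1"
  shows "d $ 1 = 0" and "p $ 1 + c = g * ((d $ 3)\<^sup>2 - (d $ 2)\<^sup>2)"
proof -
  define k3 where "k3 = d $ 1 * ((d $ 1)\<^sup>2 + (d $ 2)\<^sup>2 + (d $ 3)\<^sup>2)"
  define k2 where "k2 = (p $ 1 + c + g) * (d $ 2)\<^sup>2 + (p $ 1 + c - g) * (d $ 3)\<^sup>2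
      + d $ 1 * (2 * p $ 2 * d $ 2 + 2 * p $ 3 * d $ 3 + d $ 1 * (3 * p $ 1 + c))"
  define k1 where "k1 = d $ 1 * ((p $ 2)\<^sup>2 + (p $ 3)\<^sup>2
        + (p $ 1 + c)\<^sup>2 - g\<^sup>2 + 2 * (p $ 1 - c) * (p $ 1 + c))
      + 2 * (p $ 1 + c + g) * p $ 2 * d $ 2 + 2 * (p $ 1 + c - g) * p $ 3 * d $ 3"
  define k0 where "k0 = (p $ 1 + c + g) * (p $ 2)\<^sup>2 + (p $ 1 + c - g) * (p $ 3)\<^sup>2
      + (p $ 1 - c) * ((p $ 1 + c)\<^sup>2 - g\<^sup>2)"
  have "k0 + k1 * s + k2 * s\<^sup>2 + k3 * s ^ 3 = 0" for s
    using line[of s] unfolding mem_cyclide_iff k0_def k1_def k2_def k3_def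
    by (simp add: power2_eq_square power3_eq_cube algebra_simps)
  (* a cubic with four roots is zero *)
  from this[of 0] this[of 1] this[of "-1"] this[of 2] have k: "k3 = 0" "k2 = 0" by auto
  show 1: "d $ 1 = 0" using k(1) unit unfolding k3_def by simp
  have "(p $ 1 + c) * ((d $ 2)\<^sup>2 + (d $ 3)\<^sup>2) = g * ((d $ 3)\<^sup>2 - (d $ 2)\<^sup>2)"
    using k(2) 1 unfolding k2_def by (simp add: algebra_simps)
  then show "p $ 1 + c = g * ((d $ 3)\<^sup>2 - (d $ 2)\<^sup>2)" using unit 1 by simp
qed

lemma orthogonal_matrix_3D:
  fixes Q :: "real ^ 3 ^ 3"
  assumes "orthogonal_matrix Q"
  shows "(\<Sum>k\<in>UNIV. Q $ i $ k * Q $ j $ k) = (if i = j then 1 else 0)"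
    and "(\<Sum>k\<in>UNIV. Q $ k $ i * Q $ k $ j) = (if i = j then 1 else 0)"
proof -
  have "Q ** transpose Q = mat 1" "transpose Q ** Q = mat 1"
    using assms unfolding orthogonal_matrix_def by auto
  then show "(\<Sum>k\<in>UNIV. Q $ i $ k * Q $ j $ k) = (if i = j then 1 else 0)"
    "(\<Sum>k\<in>UNIV. Q $ k $ i * Q $ k $ j) = (if i = j then 1 else 0)"
    by (auto simp: vec_eq_iff matrix_matrix_mult_def transpose_def mat_def)
qed

text \<open>The images of the lines \<open>u = g, y = 0\<close> and \<open>u = -g, z = 0\<close> are lines in the surface, at the heights
  \<open>u = g (Q\<^sub>3\<^sub>3\<^sup>2 - Q\<^sub>2\<^sub>3\<^sup>2)\<close> and \<open>u = g (Q\<^sub>3\<^sub>2\<^sup>2 - Q\<^sub>2\<^sub>2\<^sup>2)\<close>. Orthogonality makes these heights opposite, so the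
  plane \<open>u = 0\<close> midway between the two lines is mapped to itself. On heights the
  isometry then acts as multiplication by \<open>Q\<^sub>1\<^sub>1 = \<plusminus>1\<close>, whence \<open>Q\<^sub>1\<^sub>1 = Q\<^sub>3\<^sub>3\<^sup>2 - Q\<^sub>2\<^sub>3\<^sup>2\<close>, which decides
  between sign changes and exchanges.\<close>

lemma isometry_of_cyclide_cases:
  assumes g: "g \<noteq> 0" and f: "isometry3 f" and into: "f ` cyclide c g \<subseteq> cyclide c g"
  shows "(\<exists>d\<in>{1, -1}. \<exists>e\<in>{1, -1}. f = axis_flip d e) \<or>
    c = 0 \<and> (\<exists>d\<in>{1, -1}. \<exists>e\<in>{1, -1}. f = axis_swap d e)"
proof -
  obtain Q b where orth: "orthogonal_matrix Q" and Q: "\<And>v. f v = Q *v v + b"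
    using f unfolding isometry3_def by blast
  note row = orthogonal_matrix_3D(1)[OF orth, unfolded sum_3]
  note col = orthogonal_matrix_3D(2)[OF orth, unfolded sum_3]
  have in_S: "f v \<in> cyclide c g" if "v \<in> cyclide c g" for v using into that by blast
  define p where "p = f (vector [g - c, 0, 0])"
  define q where "q = f (vector [- g - c, 0, 0])"
  have p: "p $ i = Q $ i $ 1 * (g - c) + b $ i" and q: "q $ i = Q $ i $ 1 * (- g - c) + b $ i" for i
    by (simp_all add: p_def q_def Q matrix_vector_mult_def sum_3)
  have "p + s *\<^sub>R (\<chi> i. Q $ i $ 3) = f (vector [g - c, 0, s])"
    "q + s *\<^sub>R (\<chi> i. Q $ i $ 2) = f (vector [- g - c, s, 0])" for s
    by (simp_all add: vec_eq_iff p q Q matrix_vector_mult_def sum_3)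
  moreover have "vector [g - c, 0, s] \<in> cyclide c g" "vector [- g - c, s, 0] \<in> cyclide c g" for s
    by (simp_all add: mem_cyclide_iff)
  ultimately have lines: "p + s *\<^sub>R (\<chi> i. Q $ i $ 3) \<in> cyclide c g"
    "q + s *\<^sub>R (\<chi> i. Q $ i $ 2) \<in> cyclide c g" for s
    using in_S by metis+
  have pS: "p \<in> cyclide c g" and qS: "q \<in> cyclide c g" using lines[of 0] by simp_all
  have 13: "Q $ 1 $ 3 = 0" and hp: "p $ 1 + c = g * ((Q $ 3 $ 3)\<^sup>2 - (Q $ 2 $ 3)\<^sup>2)"
    using line_in_cyclide[OF lines(1)] col[of 3 3] by (simp_all add: power2_eq_square)
  have 12: "Q $ 1 $ 2 = 0" and hq: "q $ 1 + c = g * ((Q $ 3 $ 2)\<^sup>2 - (Q $ 2 $ 2)\<^sup>2)"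
    using line_in_cyclide[OF lines(2)] col[of 2 2] by (simp_all add: power2_eq_square)
  have sq11: "(Q $ 1 $ 1)\<^sup>2 = 1" using row[of 1 1] 12 13 by (simp add: power2_eq_square)
  then have "(Q $ 2 $ 1)\<^sup>2 + (Q $ 3 $ 1)\<^sup>2 = 0" using col[of 1 1] by (simp add: power2_eq_square)
  then have 21: "Q $ 2 $ 1 = 0" and 31: "Q $ 3 $ 1 = 0" by (simp_all add: sum_power2_eq_zero_iff)
  have sq: "(Q $ 2 $ 2)\<^sup>2 + (Q $ 2 $ 3)\<^sup>2 = 1" "(Q $ 3 $ 2)\<^sup>2 + (Q $ 3 $ 3)\<^sup>2 = 1"
    "(Q $ 2 $ 3)\<^sup>2 + (Q $ 3 $ 3)\<^sup>2 = 1"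
    using row[of 2 2] row[of 3 3] col[of 3 3] 12 13 21 31 by (simp_all add: power2_eq_square)
  have "q $ 1 + c = - (p $ 1 + c)"
    unfolding hp hq using sq by (simp add: algebra_simps flip: distrib_left)
  then have b1: "b $ 1 = c * (Q $ 1 $ 1 - 1)" unfolding p q by (simp add: algebra_simps)
  then have "g * Q $ 1 $ 1 = g * ((Q $ 3 $ 3)\<^sup>2 - (Q $ 2 $ 3)\<^sup>2)"
    using hp unfolding p by (simp add: algebra_simps)
  then have Q11: "Q $ 1 $ 1 = (Q $ 3 $ 3)\<^sup>2 - (Q $ 2 $ 3)\<^sup>2" using g by simp
  consider "Q $ 1 $ 1 = 1" | "Q $ 1 $ 1 = -1" using sq11 by (auto simp: power2_eq_1_iff)
  then show ?thesis
  proof cases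
    case 1
    then have e: "(Q $ 2 $ 3)\<^sup>2 = 0" "(Q $ 3 $ 3)\<^sup>2 = 1" "(Q $ 2 $ 2)\<^sup>2 = 1" "(Q $ 3 $ 2)\<^sup>2 = 0"
      using Q11 sq by linarith+
    (* each line is mapped to itself, which excludes a translation within the planes *)
    have "b $ 1 = 0" using 1 b1 by simp
    moreover from this have "b $ 2 = 0" "b $ 3 = 0"
      using pS qS g unfolding mem_cyclide_iff p q 1 21 31 by simp_all
    ultimately have "f v = axis_flip (Q $ 2 $ 2) (Q $ 3 $ 3) v" for v
      using e 1 12 13 21 31
      by (simp add: axis_flip_def Q vec_eq_iff forall_3 matrix_vector_mult_def sum_3)
    then have "f = axis_flip (Q $ 2 $ 2) (Q $ 3 $ 3)" by blast
    then show ?thesis using e by (auto simp: power2_eq_1_iff)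
  next
    case 2
    then have e: "(Q $ 2 $ 3)\<^sup>2 = 1" "(Q $ 3 $ 3)\<^sup>2 = 0" "(Q $ 2 $ 2)\<^sup>2 = 0" "(Q $ 3 $ 2)\<^sup>2 = 1"
      using Q11 sq by linarith+
    (* u changes sign, so x is mapped to -x - 2c and the two lines are exchanged *)
    have b1: "b $ 1 = - 2 * c" using 2 b1 by simp
    then have b23: "b $ 2 = 0" "b $ 3 = 0"
      using pS qS g unfolding mem_cyclide_iff p q 2 21 31 by simp_all
    (* In the invariant plane u = 0 the surface is the hyperbola y^2 - z^2 = -2cg,
       and exchanging the coordinates reverses the sign of its left-hand side. *)
    obtain y z where yz: "y\<^sup>2 - z\<^sup>2 = - 2 * c * g"
    proof (cases "c * g \<le> 0")
      case True
      then show ?thesis using that[of "sqrt (- 2 * c * g)" 0] by simp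
    next
      case False
      then show ?thesis using that[of 0 "sqrt (2 * c * g)"] by simp
    qed
    have "vector [- c, y, z] \<in> cyclide c g"
      using arg_cong[OF yz, of "(*) g"]
      by (simp add: mem_cyclide_iff power2_eq_square algebra_simps)
    then have "f (vector [- c, y, z]) \<in> cyclide c g" by (rule in_S)
    moreover have "f (vector [- c, y, z]) = vector [- c, Q $ 2 $ 3 * z, Q $ 3 $ 2 * y]"
      using e b1 b23 2 12 13 21 31
      by (simp add: Q vec_eq_iff forall_3 matrix_vector_mult_def sum_3)
    ultimately have "g * (z\<^sup>2 - y\<^sup>2) + 2 * c * g\<^sup>2 = 0"
      using e by (simp add: mem_cyclide_iff power_mult_distrib algebra_simps)
    moreover have "z\<^sup>2 - y\<^sup>2 = 2 * c * g" using yz by simp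
    ultimately have "c = 0" using g by (simp add: power2_eq_square)
    moreover from this have "f v = axis_swap (Q $ 3 $ 2) (Q $ 2 $ 3) v" for v
      using e b1 b23 2 12 13 21 31
      by (simp add: axis_swap_def Q vec_eq_iff forall_3 matrix_vector_mult_def sum_3)
    then have "f = axis_swap (Q $ 3 $ 2) (Q $ 2 $ 3)" by blast
    ultimately show ?thesis using e by (auto simp: power2_eq_1_iff)
  qed
qed

section \<open>The group of symmetries\<close>

lemma isometry3_comp:
  assumes "isometry3 f" "isometry3 h"
  shows "isometry3 (f \<circ> h)"
proof -
  obtain P a Q b where "orthogonal_matrix P" "\<And>v. f v = P *v v + a"
    "orthogonal_matrix Q" "\<And>v. h v = Q *v v + b"
    using assms unfolding isometry3_def by blast
  then show ?thesis unfolding isometry3_def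
    by (intro exI[of _ "P ** Q"] exI[of _ "P *v b + a"])
      (simp add: orthogonal_matrix_mul matrix_vector_mul_assoc matrix_vector_right_distrib)
qed

lemma isometry3_inverse:
  assumes "isometry3 f"
  obtains h where "isometry3 h" "h \<circ> f = id" "f \<circ> h = id"
proof -
  obtain Q b where Q: "orthogonal_matrix Q" and f: "\<And>v. f v = Q *v v + b"
    using assms unfolding isometry3_def by blast
  define h where "h v = transpose Q *v v + - (transpose Q *v b)" for v
  have inv: "transpose Q *v (Q *v v) = v" "Q *v (transpose Q *v v) = v" for v
    using Q unfolding orthogonal_matrix_def
    by (simp_all only: matrix_vector_mul_assoc matrix_vector_mul_lid)
  have "isometry3 h" unfolding isometry3_def using Q h_def
    by (intro exI[of _ "transpose Q"] exI[of _ "- (transpose Q *v b)"]) simp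
  moreover have "h \<circ> f = id" "f \<circ> h = id"
    by (auto simp: fun_eq_iff f h_def inv matrix_vector_right_distrib
        matrix_vector_mult_diff_distrib simp del: transpose_matrix_vector)
  ultimately show thesis by (rule that)
qed

lemma symmetriesI:
  assumes "isometry3 f" and iff: "\<And>v. f v \<in> S \<longleftrightarrow> v \<in> S"
  shows "f \<in> symmetries S"
proof -
  obtain h where "f \<circ> h = id" using isometry3_inverse[OF assms(1)] by metis
  then have "f (h v) = v" for v by (simp add: fun_eq_iff)
  then have "f ` S = S" using iff by (metis image_subsetI image_eqI subsetI subset_antisym)
  then show ?thesis using assms(1) by (simp add: symmetries_def)
qed

lemma group_symmetry_group: "group (symmetry_group S)"
proof (rule groupI)
  fix f h assume "f \<in> carrier (symmetry_group S)" "h \<in> carrier (symmetry_group S)"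
  then show "f \<otimes>\<^bsub>symmetry_group S\<^esub> h \<in> carrier (symmetry_group S)"
    by (simp add: symmetry_group_def symmetries_def isometry3_comp image_comp[symmetric] del: comp_apply)
next
  have "isometry3 id" unfolding isometry3_def
    by (intro exI[of _ "mat 1"] exI[of _ 0]) (simp add: orthogonal_matrix_id)
  then show "\<one>\<^bsub>symmetry_group S\<^esub> \<in> carrier (symmetry_group S)"
    by (simp add: symmetry_group_def symmetries_def)
next
  fix f assume "f \<in> carrier (symmetry_group S)"
  then have f: "isometry3 f" "f ` S = S" by (simp_all add: symmetry_group_def symmetries_def)
  obtain h where h: "isometry3 h" "h \<circ> f = id" by (rule isometry3_inverse[OF f(1)])
  have "h ` S = (h \<circ> f) ` S" using f(2) by (metis image_comp)
  then have "h ` S = S" using h(2) by simp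
  then show "\<exists>h\<in>carrier (symmetry_group S).
      h \<otimes>\<^bsub>symmetry_group S\<^esub> f = \<one>\<^bsub>symmetry_group S\<^esub>"
    using h by (auto simp: symmetry_group_def symmetries_def)
qed (simp_all add: symmetry_group_def comp_assoc)

lemma case_maps_a_d: "case_maps cases_a_d = {axis_flip d e | d e. d \<in> {1, -1} \<and> e \<in> {1, -1}}"
  unfolding case_maps_def mem_cases_a_d_iff by blast

lemma case_maps_i_l: "case_maps cases_i_l = {axis_swap d e | d e. d \<in> {1, -1} \<and> e \<in> {1, -1}}"
  unfolding case_maps_def mem_cases_i_l_iff by blast

lemma axis_flip_symmetry:
  assumes "d \<in> {1, -1}" "e \<in> {1, -1}"
  shows "axis_flip d e \<in> symmetries (cyclide c g)"
proof (rule symmetriesI)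
  show "isometry3 (axis_flip d e)" using assms by (auto intro: isometry3_axis_flip)
  show "axis_flip d e v \<in> cyclide c g \<longleftrightarrow> v \<in> cyclide c g" for v
    using assms by (auto simp: mem_cyclide_iff axis_flip_def)
qed

text \<open>For \<open>c = 0\<close> the exchanges change the sign of the defining polynomial.\<close>

lemma axis_swap_symmetry:
  assumes "d \<in> {1, -1}" "e \<in> {1, -1}"
  shows "axis_swap d e \<in> symmetries (cyclide 0 g)"
proof (rule symmetriesI)
  show "isometry3 (axis_swap d e)" using assms by (auto intro: isometry3_axis_swap)
  define F where "F v = (v $ 1 + g) * (v $ 2)\<^sup>2 + (v $ 1 - g) * (v $ 3)\<^sup>2
    + v $ 1 * ((v $ 1)\<^sup>2 - g\<^sup>2)" for v :: "real ^ 3"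
  have "F (axis_swap d e v) = - F v" for v
    using assms by (auto simp: F_def axis_swap_def algebra_simps)
  then show "axis_swap d e v \<in> cyclide 0 g \<longleftrightarrow> v \<in> cyclide 0 g" for v
    by (simp add: mem_cyclide_iff flip: F_def)
qed

lemma symmetries_cyclide:
  assumes "g \<noteq> 0"
  shows "symmetries (cyclide c g) =
    case_maps cases_a_d \<union> (if c = 0 then case_maps cases_i_l else {})"
proof (intro subset_antisym subsetI)
  fix f assume "f \<in> symmetries (cyclide c g)"
  then have "isometry3 f" "f ` cyclide c g \<subseteq> cyclide c g" by (auto simp: symmetries_def)
  from isometry_of_cyclide_cases[OF assms this]
  show "f \<in> case_maps cases_a_d \<union> (if c = 0 then case_maps cases_i_l else {})"
    unfolding case_maps_a_d case_maps_i_l by auto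
next
  fix f assume "f \<in> case_maps cases_a_d \<union> (if c = 0 then case_maps cases_i_l else {})"
  then show "f \<in> symmetries (cyclide c g)"
    unfolding case_maps_a_d case_maps_i_l
    by (auto split: if_splits intro: axis_flip_symmetry axis_swap_symmetry simp del: insert_iff)
qed

lemma symmetry_group_iso_klein:
  assumes "symmetries S = case_maps cases_a_d"
  shows "symmetry_group S \<cong> klein_four_group"
proof -
  define s where "s i = (if i = 0 then 1 else - 1 :: real)" for i :: int
  define h where "h = (\<lambda>(i, j). axis_flip (s i) (s j))"
  have two: "{0..<2} = {0, 1 :: int}" by auto
  have carrier: "carrier klein_four_group = {0, 1} \<times> {0, 1}"
    by (simp add: klein_four_group_def integer_mod_group_def two)
  have "h \<in> hom klein_four_group (symmetry_group S)"
  proof (rule homI)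
    show "h x \<in> carrier (symmetry_group S)" for x
      by (auto simp: h_def s_def symmetry_group_def assms case_maps_a_d split: prod.splits)
    show "h (x \<otimes>\<^bsub>klein_four_group\<^esub> y) = h x \<otimes>\<^bsub>symmetry_group S\<^esub> h y"
      if "x \<in> carrier klein_four_group" "y \<in> carrier klein_four_group" for x y
      using that unfolding carrier
      by (auto simp: h_def s_def symmetry_group_def klein_four_group_def integer_mod_group_def
          axis_flip_swap_comp)
  qed
  moreover have "inj_on h (carrier klein_four_group)"
    unfolding carrier by (auto simp: inj_on_def h_def s_def axis_flip_swap_eq_iff)
  moreover have "h ` carrier klein_four_group = carrier (symmetry_group S)"
    unfolding carrier
    by (auto simp: h_def s_def symmetry_group_def assms case_maps_a_d)
  ultimately have "h \<in> iso klein_four_group (symmetry_group S)"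
    by (simp add: iso_def bij_betw_def)
  then have "klein_four_group \<cong> symmetry_group S" by (auto simp: is_iso_def)
  moreover have "group klein_four_group" by (simp add: klein_four_group_def DirProd_group)
  ultimately show ?thesis by (simp add: group.iso_sym)
qed

text \<open>The quarter turn \<open>\<rho> = axis_swap 1 (-1)\<close> has the powers \<open>axis_flip (-1) (-1)\<close> and
  \<open>axis_swap (-1) 1\<close>, and \<open>\<sigma> = axis_flip 1 (-1)\<close> satisfies \<open>\<sigma>\<rho> = \<rho>\<^sup>-\<^sup>1\<sigma>\<close>. Multiplication by \<open>\<sigma>\<close> on the
  right negates the second sign only.\<close>

lemma symmetry_group_iso_dihedral:
  assumes "symmetries S = case_maps cases_a_d \<union> case_maps cases_i_l"
  shows "symmetry_group S \<cong> dihedral_group 4"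
proof -
  (* d k and e k are the two signs of the k-th power of the quarter turn *)
  define d where "d k = (if k \<le> 1 then 1 else - 1 :: real)" for k :: int
  define e where "e k = (if k = 0 \<or> k = 3 then 1 else - 1 :: real)" for k :: int
  define h where "h = (\<lambda>(k, s). (if even k then axis_flip else axis_swap)
    (d k) (if s then - e k else e k))"
  have four: "{0..<4} = {0, 1, 2, 3 :: int}" by auto
  have carrier: "carrier (dihedral_group 4) = {0, 1, 2, 3} \<times> {False, True}"
    by (auto simp add: dihedral_group_def four)
  have "h \<in> hom (dihedral_group 4) (symmetry_group S)"
  proof (rule homI)
    show "h x \<in> carrier (symmetry_group S)" for x
      by (auto simp: h_def d_def e_def symmetry_group_def assms case_maps_a_d case_maps_i_l
          split: prod.splits)
    show "h (x \<otimes>\<^bsub>dihedral_group 4\<^esub> y) = h x \<otimes>\<^bsub>symmetry_group S\<^esub> h y"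
      if "x \<in> carrier (dihedral_group 4)" "y \<in> carrier (dihedral_group 4)" for x y
      using that unfolding carrier
      by (auto simp: h_def d_def e_def symmetry_group_def dihedral_group_def axis_flip_swap_comp)
  qed
  moreover have "inj_on h (carrier (dihedral_group 4))"
    unfolding carrier by (auto simp: inj_on_def h_def d_def e_def axis_flip_swap_eq_iff)
  moreover have "h ` carrier (dihedral_group 4) = carrier (symmetry_group S)"
    unfolding carrier
    by (auto simp: h_def d_def e_def symmetry_group_def assms case_maps_a_d case_maps_i_l)
  ultimately have "h \<in> iso (dihedral_group 4) (symmetry_group S)"
    by (simp add: iso_def bij_betw_def)
  then have "dihedral_group 4 \<cong> symmetry_group S" by (auto simp: is_iso_def)
  moreover have "group (dihedral_group 4)" by (simp add: group_dihedral_group)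
  ultimately show ?thesis by (simp add: group.iso_sym)
qed

theorem theorem14:
  fixes c g :: real
  assumes "g \<noteq> 0"
  shows
    "(\<forall>f \<phi>\<^sub>1 \<phi>\<^sub>2. isometry3 f \<and> moebius_transf \<phi>\<^sub>1 \<and> moebius_transf \<phi>\<^sub>2 \<longrightarrow>
        (condA c g f \<phi>\<^sub>1 \<phi>\<^sub>2 \<longleftrightarrow> (\<phi>\<^sub>1, \<phi>\<^sub>2, f) \<in> cases_a_d)) \<and>
     (\<forall>f \<phi>\<^sub>1 \<phi>\<^sub>2. isometry3 f \<and> moebius_transf \<phi>\<^sub>1 \<and> moebius_transf \<phi>\<^sub>2 \<longrightarrow>
        (condB c g f \<phi>\<^sub>1 \<phi>\<^sub>2 \<longleftrightarrow> c = 0 \<and> (\<phi>\<^sub>1, \<phi>\<^sub>2, f) \<in> cases_i_l)) \<and>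
     (c \<noteq> 0 \<longrightarrow>
        symmetries (cyclide c g) = case_maps cases_a_d \<and>
        group (symmetry_group (cyclide c g)) \<and>
        symmetry_group (cyclide c g) \<cong> klein_four_group) \<and>
     (c = 0 \<longrightarrow>
        symmetries (cyclide c g) = case_maps cases_a_d \<union> case_maps cases_i_l \<and>
        group (symmetry_group (cyclide c g)) \<and>
        symmetry_group (cyclide c g) \<cong> dihedral_group 4)"
  using condA_iff[OF assms] condB_iff[OF assms] symmetries_cyclide[OF assms, of c]
    group_symmetry_group[of "cyclide c g"] symmetry_group_iso_klein[of "cyclide c g"]
    symmetry_group_iso_dihedral[of "cyclide c g"]
  by (cases "c = 0") simp_all

end
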